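(* Let $S$ be a dense subset of $[0,\infty)$ with $0\in S$. Let $X$ be a strongly $0$-dimensional metrizable space. Then the set $\mathrm{CT}(X;S)$ is meager in $\mathrm{Met}(X)$.
   Context: A topological space $X$ is strongly $0$-dimensional if for every pair $A, B$ of disjoint closed subsets of $X$ there exists a clopen set $V$ with $A\subset V$ and $V\cap B=\emptyset$. For a metrizable space $X$, $\mathrm{Met}(X)$ denotes the set of all metrics on $X$ that generate the given topology of $X$, with the topology generated by the open balls of the $[0,\infty]$-valued metric $\mathcal{D}_{X}(d,e)=\sup_{x,y\in X}|d(x,y)-e(x,y)|$. For a class $\mathscr{M}$ of metric spaces, a metric space $(X,d)$ (and also the metric $d$) is called $\mathscr{M}$-universal if every $(Y,e)\in\mathscr{M}$ admits an isometric embedding into $(X,d)$. For $S\subset[0,\infty)$ with $0\in S$, $\mathscr{T}(S)$ is the class of all two-point metric spaces whose metrics take values in $S$. $\mathrm{T}(X;S)$ is the set of all $\mathscr{T}(S)$-universal metrics in $\mathrm{Met}(X)$, and $\mathrm{CT}(X;S)$ is the closure of $\mathrm{T}(X;S)$ in $\mathrm{Met}(X)$. A subset of a topological space is meager if it is a countable union of nowhere dense subsets. *)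

theory Defs
  imports "HOL-Analysis.Analysis"
begin

text \<open>This is large inductive dimension zero. The library's \<open>X dim_le 0\<close> is about the small
  inductive dimension and is strictly weaker, even for metrizable spaces (Roy's space).\<close>

definition strongly_0_dimensional :: "'a topology \<Rightarrow> bool" where
  "strongly_0_dimensional X \<longleftrightarrow>
     (\<forall>A B. closedin X A \<and> closedin X B \<and> A \<inter> B = {} \<longrightarrow>
        (\<exists>V. closedin X V \<and> openin X V \<and> A \<subseteq> V \<and> V \<inter> B = {}))"

definition nowhere_dense_in :: "'a topology \<Rightarrow> 'a set \<Rightarrow> bool" where
  "nowhere_dense_in X A \<longleftrightarrow> A \<subseteq> topspace X \<and> X interior_of (X closure_of A) = {}"

definition meager_in :: "'a topology \<Rightarrow> 'a set \<Rightarrow> bool" where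
  "meager_in X A \<longleftrightarrow> (\<exists>\<N>. countable \<N> \<and> (\<forall>N\<in>\<N>. nowhere_dense_in X N) \<and> A = \<Union>\<N>)"

text \<open>A metric on the set \<open>topspace X\<close> is represented by a HOL function on the whole type that is
  \<open>0\<close> as soon as one argument lies outside \<open>topspace X\<close>. This makes the representation
  unique, so that \<open>Met X\<close> is in bijection with the set of compatible metrics.\<close>

definition Met :: "'a topology \<Rightarrow> ('a \<Rightarrow> 'a \<Rightarrow> real) set" where
  "Met X = {d. Metric_space (topspace X) d \<and> Metric_space.mtopology (topspace X) d = X \<and>
               (\<forall>x y. x \<notin> topspace X \<or> y \<notin> topspace X \<longrightarrow> d x y = 0)}"

definition Met_dist ::
    "'a topology \<Rightarrow> ('a \<Rightarrow> 'a \<Rightarrow> real) \<Rightarrow> ('a \<Rightarrow> 'a \<Rightarrow> real) \<Rightarrow> ennreal" where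
  "Met_dist X d e = (SUP (x, y) \<in> topspace X \<times> topspace X. ennreal \<bar>d x y - e x y\<bar>)"

definition Met_topology :: "'a topology \<Rightarrow> ('a \<Rightarrow> 'a \<Rightarrow> real) topology" where
  "Met_topology X =
     topology_generated_by {{e \<in> Met X. Met_dist X d e < r} |d r. d \<in> Met X \<and> 0 < r}"

definition isometric_embedding :: "'b metric \<Rightarrow> 'a metric \<Rightarrow> ('b \<Rightarrow> 'a) \<Rightarrow> bool" where
  "isometric_embedding m m' f \<longleftrightarrow> f \<in> mspace m \<rightarrow> mspace m' \<and>
     (\<forall>x\<in>mspace m. \<forall>y\<in>mspace m. mdist m' (f x) (f y) = mdist m x y)"

definition universal_metric :: "'b metric set \<Rightarrow> 'a metric \<Rightarrow> bool" where
  "universal_metric \<M> m \<longleftrightarrow> (\<forall>m'\<in>\<M>. \<exists>f. isometric_embedding m' m f)"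

definition two_point_spaces :: "real set \<Rightarrow> 'b metric set" where
  "two_point_spaces S =
     {m. card (mspace m) = 2 \<and> (\<forall>x\<in>mspace m. \<forall>y\<in>mspace m. mdist m x y \<in> S)}"

text \<open>HOL cannot quantify over the class of all two-point metric spaces at once. It suffices to
  take those whose points are natural numbers, as every two-point space is isometric to one of
  them; see \<open>universal_two_point_spaces_any_type\<close> below.\<close>

definition T_Met :: "'a topology \<Rightarrow> real set \<Rightarrow> ('a \<Rightarrow> 'a \<Rightarrow> real) set" where
  "T_Met X S = {d \<in> Met X.
     universal_metric (two_point_spaces S :: nat metric set) (metric (topspace X, d))}"

definition CT_Met :: "'a topology \<Rightarrow> real set \<Rightarrow> ('a \<Rightarrow> 'a \<Rightarrow> real) set" where
  "CT_Met X S = Met_topology X closure_of T_Met X S"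

lemma universal_two_point_spaces_any_type:
  fixes m :: "'a metric"
  assumes "universal_metric (two_point_spaces S :: nat metric set) m"
  shows "universal_metric (two_point_spaces S :: 'b metric set) m"
  unfolding universal_metric_def
proof
  fix m' :: "'b metric"
  assume m': "m' \<in> two_point_spaces S"
  then have c: "card (mspace m') = 2" by (simp add: two_point_spaces_def)
  then have "finite (mspace m')" by (metis card.infinite zero_neq_numeral)
  with c obtain h where h: "bij_betw h {0..<2::nat} (mspace m')"
    by (metis ex_bij_betw_nat_finite)
  define d where "d = (\<lambda>i j. if i < 2 \<and> j < 2 then mdist m' (h i) (h j) else 0)"
  have hin: "h i \<in> mspace m'" if "i < 2" for i
    using h that by (auto simp: bij_betw_def)
  have inj: "h i = h j \<longleftrightarrow> i = j" if "i < 2" "j < 2" for i j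
    using h that by (auto simp: bij_betw_def inj_on_def)
  have M: "Metric_space {0..<2::nat} d"
    by unfold_locales (auto simp: d_def hin inj mdist_commute intro: mdist_triangle)
  have sp: "mspace (metric ({0..<2}, d)) = {0..<2}" "mdist (metric ({0..<2}, d)) = d"
    using M by (simp_all add: Metric_space.mspace_metric Metric_space.mdist_metric)
  have "metric ({0..<2}, d) \<in> two_point_spaces S"
    using m' hin unfolding two_point_spaces_def mem_Collect_eq sp by (auto simp: d_def)
  then obtain f where f: "isometric_embedding (metric ({0..<2}, d)) m f"
    using assms by (auto simp: universal_metric_def)
  define g where "g = inv_into {0..<2} h"
  have g: "g x < 2" "h (g x) = x" if "x \<in> mspace m'" for x
    using h that inv_into_into[of x h "{0..<2}"] f_inv_into_f[of x h "{0..<2}"]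
    by (auto simp: g_def bij_betw_def)
  have "isometric_embedding m' m (f \<circ> g)"
    using f g unfolding isometric_embedding_def sp by (auto simp: d_def Pi_iff)
  then show "\<exists>f. isometric_embedding m' m f" by blast
qed

end

theory Submission
  imports Defs
begin

text \<open>Every metric in \<open>CT_Met X S\<close> has a dense set of values, and this fails on an open dense
  subset of \<open>Met X\<close>. Indeed, strong zero-dimensionality yields a locally constant map \<open>p\<close> that moves
  points by less than a given amount. Keep \<open>d\<close> on the fibres of \<open>p\<close>, and round the distances
  between the images of \<open>p\<close> up to multiples of \<open>K\<close> for points in different fibres. If
  the fibres have diameter less than \<open>K / 4\<close>, this is a compatible metric close to \<open>d\<close> that has no
  value in the interval from \<open>K / 4\<close> to \<open>K\<close>, and a slight perturbation of it still omits an
  interval.\<close>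

section \<open>Locally constant approximations of the identity\<close>

text \<open>As in Stone's proof of paracompactness, \<open>q y\<close> is the first centre, in a well-ordering of the
  space, whose ball contains \<open>y\<close>.\<close>

lemma (in Metric_space) exists_first_centre:
  assumes "0 < \<epsilon>"
  obtains q where "\<And>y. y \<in> M \<Longrightarrow> q y \<in> M" "\<And>y. y \<in> M \<Longrightarrow> d (q y) y < \<epsilon>"
    "\<And>y z. \<lbrakk>y \<in> M; z \<in> M; q y \<noteq> q z\<rbrakk> \<Longrightarrow> \<epsilon> \<le> d (q z) y \<or> \<epsilon> \<le> d (q y) z"
proof -
  obtain r :: "'a rel" where r: "Well_order r" "Field r = UNIV"
    using well_ordering by metis
  then have wf: "wf (r - Id)" and "total_on UNIV r"
    unfolding well_order_on_def linear_order_on_def by simp_all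
  then have tot: "(x, y) \<in> r \<or> (y, x) \<in> r" if "x \<noteq> y" for x y
    using that unfolding total_on_def by blast
  have "\<forall>y\<in>M. \<exists>x. x \<in> M \<and> d x y < \<epsilon> \<and> (\<forall>x'. (x', x) \<in> r - Id \<longrightarrow> x' \<in> M \<longrightarrow> \<epsilon> \<le> d x' y)"
  proof
    fix y assume "y \<in> M"
    then have "y \<in> {x \<in> M. d x y < \<epsilon>}"
      using assms by simp
    from wfE_min[OF wf this] obtain x where "x \<in> {x \<in> M. d x y < \<epsilon>}"
      "\<And>x'. (x', x) \<in> r - Id \<Longrightarrow> x' \<notin> {x \<in> M. d x y < \<epsilon>}" by blast
    then show "\<exists>x. x \<in> M \<and> d x y < \<epsilon> \<and> (\<forall>x'. (x', x) \<in> r - Id \<longrightarrow> x' \<in> M \<longrightarrow> \<epsilon> \<le> d x' y)"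
      by (intro exI[of _ x]) force
  qed
  from bchoice[OF this] obtain q where q: "\<forall>y\<in>M. q y \<in> M \<and> d (q y) y < \<epsilon> \<and>
      (\<forall>x'. (x', q y) \<in> r - Id \<longrightarrow> x' \<in> M \<longrightarrow> \<epsilon> \<le> d x' y)" by (elim exE)
  show thesis
  proof
    fix y z assume "y \<in> M" "z \<in> M" "q y \<noteq> q z"
    \<comment> \<open>The earlier of two distinct centres was rejected by the point assigned to the
      later one, so it is at least \<open>\<epsilon>\<close> away from that point.\<close>
    moreover have "(q z, q y) \<in> r - Id \<or> (q y, q z) \<in> r - Id"
      using tot \<open>q y \<noteq> q z\<close> by auto
    ultimately show "\<epsilon> \<le> d (q z) y \<or> \<epsilon> \<le> d (q y) z"
      using q by blast
  qed (use q in auto)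
qed

text \<open>The map \<open>q\<close> of first centres need not be locally constant, but on the set
  \<open>S n\<close> of points with margin \<open>h n\<close> inside their ball it is constant at
  scale \<open>h n\<close>. Strong zero-dimensionality thickens each \<open>S n\<close> to a clopen
  set \<open>V n\<close>; then \<open>p\<close> is \<open>q\<close> applied to a nearby point of
  \<open>S n\<close>, for the first \<open>n\<close> with the given point in
  \<open>V n\<close>.\<close>

lemma (in Metric_space) exists_locally_constant_approximation:
  assumes "strongly_0_dimensional mtopology" and "0 < \<epsilon>"
  obtains p where "\<And>x. x \<in> M \<Longrightarrow> p x \<in> M" "\<And>x. x \<in> M \<Longrightarrow> d (p x) x < \<epsilon>"
    "\<And>x. x \<in> M \<Longrightarrow> \<exists>\<rho>>0. \<forall>y\<in>M. d x y < \<rho> \<longrightarrow> p y = p x"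
proof -
  obtain q where qM: "\<And>y. y \<in> M \<Longrightarrow> q y \<in> M" and qd: "\<And>y. y \<in> M \<Longrightarrow> d (q y) y < \<epsilon>"
    and q: "\<And>y z. \<lbrakk>y \<in> M; z \<in> M; q y \<noteq> q z\<rbrakk> \<Longrightarrow> \<epsilon> \<le> d (q z) y \<or> \<epsilon> \<le> d (q y) z"
    using exists_first_centre[OF \<open>0 < \<epsilon>\<close>] by blast
  define h :: "nat \<Rightarrow> real" where "h n = 1 / real (Suc n)" for n
  have h: "0 < h n" for n by (simp add: h_def)
  define S where "S n = {y \<in> M. d (q y) y \<le> \<epsilon> - h n}" for n
  have sep: "q y = q z" if "y \<in> S n" "z \<in> S n" "d y z < h n" for y z n
  proof (rule ccontr)
    assume ne: "q y \<noteq> q z"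
    have yz: "y \<in> M" "z \<in> M" "d (q y) y \<le> \<epsilon> - h n" "d (q z) z \<le> \<epsilon> - h n"
      using that by (auto simp: S_def)
    then have "d (q z) y \<le> d (q z) z + d y z" "d (q y) z \<le> d (q y) y + d y z"
      using triangle[of "q z" z y] triangle[of "q y" y z] qM by (simp_all add: commute)
    with q[OF yz(1,2) ne] yz that(3) show False by linarith
  qed
  \<comment> \<open>A third of the margin, because two points of \<open>S n\<close> will later be
    compared along a path of three steps, each shorter than \<open>h n / 3\<close>.\<close>
  define U where "U n = (\<Union>y\<in>S n. mball y (h n / 3))" for n
  have "\<exists>V. closedin mtopology V \<and> openin mtopology V \<and> S n \<subseteq> V \<and> V \<subseteq> U n" for n
  proof -
    have "openin mtopology (U n)" by (auto simp: U_def)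
    then have c: "closedin mtopology (M - U n)"
      by (metis closedin_diff closedin_topspace topspace_mtopology)
    have "mtopology closure_of S n \<subseteq> U n"
    proof
      fix x assume "x \<in> mtopology closure_of S n"
      then obtain y where "y \<in> S n" "y \<in> mball x (h n / 3)"
        using h[of n] unfolding metric_closure_of by (smt (verit) mem_Collect_eq divide_pos_pos)
      then show "x \<in> U n"
        unfolding U_def by (auto simp: commute)
    qed
    then have "mtopology closure_of S n \<inter> (M - U n) = {}" by blast
    with assms(1) c obtain V where V: "closedin mtopology V" "openin mtopology V"
        "mtopology closure_of S n \<subseteq> V" "V \<inter> (M - U n) = {}"
      unfolding strongly_0_dimensional_def by (metis closedin_closure_of)
    moreover have "S n \<subseteq> mtopology closure_of S n"
      by (rule closure_of_subset) (auto simp: S_def)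
    moreover have "V \<subseteq> M" using closedin_subset[OF V(1)] by simp
    ultimately show ?thesis by blast
  qed
  then obtain V where Vc: "\<And>n. closedin mtopology (V n)" and Vo: "\<And>n. openin mtopology (V n)"
    and SV: "\<And>n. S n \<subseteq> V n" and VU: "\<And>n. V n \<subseteq> U n"
    by metis
  define N where "N y = (LEAST n. y \<in> V n)" for y
  \<comment> \<open>The margins \<open>h n\<close> tend to 0 and
    \<open>d (q y) y < \<epsilon>\<close>, so the sets \<open>S n\<close> exhaust
    \<open>M\<close>.\<close>
  have N: "y \<in> V (N y)" if "y \<in> M" for y
  proof -
    have pos: "0 < \<epsilon> - d (q y) y" using qd[OF that] by simp
    obtain n where "h n < \<epsilon> - d (q y) y"
      using nat_approx_posE[OF pos] unfolding h_def by auto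
    then have "y \<in> S n" using that by (simp add: S_def)
    then have "y \<in> V n" using SV by blast
    then show ?thesis unfolding N_def by (rule LeastI)
  qed
  have "\<forall>y\<in>M. \<exists>w. w \<in> S (N y) \<and> y \<in> mball w (h (N y) / 3)"
    using N VU unfolding U_def by blast
  then obtain w where w: "\<And>y. y \<in> M \<Longrightarrow> w y \<in> S (N y)" "\<And>y. y \<in> M \<Longrightarrow> d (w y) y < h (N y) / 3"
    by (metis in_mball)
  have wM: "w y \<in> M" if "y \<in> M" for y using w(1)[OF that] by (simp add: S_def)
  show thesis
  proof
    show "q (w x) \<in> M" if "x \<in> M" for x
      using that qM wM by blast
    show "d (q (w x)) x < \<epsilon>" if "x \<in> M" for x
    proof -
      have "d (q (w x)) (w x) \<le> \<epsilon> - h (N x)" using w(1)[OF that] by (simp add: S_def)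
      with triangle[of "q (w x)" "w x" x] w(2)[OF that] h[of "N x"] that qM wM show ?thesis
        by fastforce
    qed
    show "\<exists>\<rho>>0. \<forall>y\<in>M. d x y < \<rho> \<longrightarrow> q (w y) = q (w x)" if x: "x \<in> M" for x
    proof -
      let ?n = "N x"
      \<comment> \<open>This is where \<open>N\<close> is locally constant: \<open>V ?n\<close> is
        open and the finitely many earlier sets are closed.\<close>
      have "openin mtopology (V ?n - (\<Union>m<?n. V m))"
        by (intro openin_diff Vo closedin_Union) (auto simp: Vc)
      moreover have "x \<in> V ?n - (\<Union>m<?n. V m)"
        using N[OF x] not_less_Least unfolding N_def by blast
      ultimately obtain r where r: "r > 0" "mball x r \<subseteq> V ?n - (\<Union>m<?n. V m)"
        unfolding openin_mtopology by blast
      have "q (w y) = q (w x)" if y: "y \<in> M" "d x y < min r (h ?n / 3)" for y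
      proof -
        have "y \<in> V ?n - (\<Union>m<?n. V m)" using r x y by auto
        then have Ny: "N y = ?n"
          unfolding N_def[of y] by (intro Least_equality) (auto simp: not_less[symmetric])
        have "d (w y) (w x) \<le> d (w y) y + d x y + d (w x) x"
          using triangle[of "w y" y "w x"] triangle[of y x "w x"] wM x y
          by (simp add: commute)
        also have "\<dots> < h ?n" using w(2)[OF x] w(2)[OF y(1)] y(2) Ny by simp
        finally show ?thesis using sep w(1)[OF x] w(1)[OF y(1)] Ny by metis
      qed
      then show ?thesis using r(1) h[of ?n] by (intro exI[of _ "min r (h ?n / 3)"]) auto
    qed
  qed
qed

section \<open>Metrics with a gap in their values\<close>

text \<open>Rounding up to multiples of \<open>K\<close> is monotone and subadditive, so it respects
  the triangle inequality. The topology survives because \<open>p\<close> is locally constant: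
  \<open>d\<close> and the new metric agree between a point and all points near it.\<close>

lemma exists_near_metric_omitting_interval:
  assumes X: "strongly_0_dimensional X" and d: "d \<in> Met X" and K: "0 < K"
  obtains e where "e \<in> Met X" "Met_dist X d e \<le> ennreal (2 * K)"
    "\<And>x y. e x y < K / 4 \<or> K \<le> e x y"
proof -
  define M where "M = topspace X"
  interpret Metric_space M d using d by (simp add: Met_def M_def)
  have top: "mtopology = X"
    using d by (auto simp: Met_def M_def)
  obtain p where pM: "\<And>x. x \<in> M \<Longrightarrow> p x \<in> M" and pd: "\<And>x. x \<in> M \<Longrightarrow> d (p x) x < K / 8"
    and p: "\<And>x. x \<in> M \<Longrightarrow> \<exists>\<rho>>0. \<forall>y\<in>M. d x y < \<rho> \<longrightarrow> p y = p x"
    using exists_locally_constant_approximation[of "K / 8"] X K top by auto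
  define g where "g t = K * of_int \<lceil>t / K\<rceil>" for t
  have g_lower: "t \<le> g t" and g_upper: "g t < t + K" for t
    using ceiling_divide_upper[OF K, of t] ceiling_divide_lower[OF K, of t]
    unfolding g_def by (simp_all add: algebra_simps)
  have g_ge: "K \<le> g t" if "0 < t" for t
  proof -
    have "0 < t / K" using K that by simp
    then have "1 \<le> \<lceil>t / K\<rceil>" by (simp only: one_le_ceiling)
    then have "(1::real) \<le> of_int \<lceil>t / K\<rceil>" by linarith
    with K show ?thesis unfolding g_def by simp
  qed
  have g_sub: "g u \<le> g s + g t" if "u \<le> s + t" for s t u
  proof -
    have "u / K \<le> s / K + t / K"
      using K that by (simp add: divide_right_mono flip: add_divide_distrib)
    then have "\<lceil>u / K\<rceil> \<le> \<lceil>s / K\<rceil> + \<lceil>t / K\<rceil>" by linarith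
    then have "real_of_int \<lceil>u / K\<rceil> \<le> of_int \<lceil>s / K\<rceil> + of_int \<lceil>t / K\<rceil>" by linarith
    with K show ?thesis unfolding g_def by (simp flip: distrib_left)
  qed
  \<comment> \<open>The value 0 outside \<open>M\<close> is the normalization required by
    \<open>Met\<close>.\<close>
  define e where "e x y = (if x \<in> M \<and> y \<in> M then
    if p x = p y then d x y else g (d (p x) (p y)) else 0)" for x y
  have near: "d x y < K / 4" if "x \<in> M" "y \<in> M" "p x = p y" for x y
    using triangle[of x "p x" y] pd[of x] pd[of y] pM[of x] that by (simp add: commute)
  have far: "K \<le> e x y" if "x \<in> M" "y \<in> M" "p x \<noteq> p y" for x y
    using that pM g_ge[of "d (p x) (p y)"] by (simp add: e_def)
  have small: "e x y < K / 4" if "x \<in> M" "y \<in> M" "p x = p y" for x y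
    using that near by (simp add: e_def)
  have gap: "e x y < K / 4 \<or> K \<le> e x y" for x y
    using small far K by (cases "x \<in> M \<and> y \<in> M") (auto simp: e_def)
  have e_nonneg: "0 \<le> e x y" for x y
    using order_trans[OF nonneg g_lower, of "p x" "p y"] by (auto simp: e_def)
  \<comment> \<open>A detour out of a fibre costs at least \<open>K\<close>, more than the fibre's
    diameter. If \<open>y\<close> shares a fibre with just one endpoint, the distance between fibres
    already occurs on the right. For three fibres, \<open>g_sub\<close> applies.\<close>
  have "e x z \<le> e x y + e y z" if xyz: "x \<in> M" "y \<in> M" "z \<in> M" for x y z
  proof (cases "p x = p z")
    case True
    then show ?thesis
    proof (cases "p x = p y")
      case False
      then show ?thesis using small[of x z] far[of x y] e_nonneg[of y z] K True xyz by linarith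
    qed (use xyz triangle in \<open>simp add: e_def\<close>)
  next
    case False
    then consider "p x = p y" | "p y = p z" | "p x \<noteq> p y" "p y \<noteq> p z" by blast
    then show ?thesis
    proof cases
      case 3
      then show ?thesis using False xyz g_sub[OF triangle[of "p x" "p y" "p z"]] pM
        by (simp add: e_def)
    qed (use False xyz in \<open>auto simp: e_def\<close>)
  qed
  then interpret E: Metric_space M e
  proof unfold_locales
    fix x y assume xy: "x \<in> M" "y \<in> M"
    show "e x y = 0 \<longleftrightarrow> x = y"
      using far[of x y] xy K by (cases "p x = p y") (auto simp: e_def)
  qed (use e_nonneg in \<open>auto simp: e_def commute\<close>)
  have eq: "e x y = d x y" if "x \<in> M" "y \<in> M" "p y = p x" for x y
    using that by (simp add: e_def)
  have ball: "(\<exists>r>0. mball x r \<subseteq> U) \<longleftrightarrow> (\<exists>r>0. E.mball x r \<subseteq> U)" if x: "x \<in> M" for x U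
  proof -
    obtain \<rho> where \<rho>: "\<rho> > 0" "\<And>y. y \<in> M \<Longrightarrow> d x y < \<rho> \<Longrightarrow> p y = p x" using p[OF x] by blast
    \<comment> \<open>Below \<open>K\<close> in \<open>e\<close>, or below \<open>\<rho>\<close> in
      \<open>d\<close>, a point lies in the fibre of \<open>x\<close>, where the two metrics
      coincide.\<close>
    have "E.mball x (min r K) \<subseteq> mball x r" for r
    proof
      fix y assume "y \<in> E.mball x (min r K)"
      then have y: "y \<in> M" "e x y < r" "e x y < K" by auto
      with far[OF x, of y] have "p y = p x" by force
      with y eq[OF x y(1)] x show "y \<in> mball x r" by simp
    qed
    moreover have "mball x (min r \<rho>) \<subseteq> E.mball x r" for r
    proof
      fix y assume "y \<in> mball x (min r \<rho>)"
      then have y: "y \<in> M" "d x y < r" "d x y < \<rho>" by auto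
      with eq[OF x y(1)] \<rho>(2)[OF y(1,3)] x show "y \<in> E.mball x r" by simp
    qed
    moreover have "0 < r \<Longrightarrow> 0 < min r K" "0 < r \<Longrightarrow> 0 < min r \<rho>" for r
      using K \<rho>(1) by simp_all
    ultimately show ?thesis by (meson subset_trans)
  qed
  have "E.mtopology = mtopology"
    using ball unfolding topology_eq openin_mtopology E.openin_mtopology by blast
  then have "e \<in> Met X"
    using E.Metric_space_axioms top unfolding Met_def M_def[symmetric] by (auto simp: e_def)
  moreover have "\<bar>d x y - e x y\<bar> \<le> 2 * K" if xy: "x \<in> M" "y \<in> M" for x y
  proof (cases "p x = p y")
    case False
    \<comment> \<open>Moving both endpoints costs at most \<open>K / 4\<close> and rounding less
      than \<open>K\<close>, which stays below \<open>2 * K\<close>.\<close>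
    have "\<bar>d x y - d (p x) (p y)\<bar> \<le> K / 4"
      using pd[OF xy(1)] pd[OF xy(2)] commute[of x "p x"] commute[of y "p y"]
        triangle[OF xy(1) pM[OF xy(1)] xy(2)] triangle[OF pM[OF xy(1)] pM[OF xy(2)] xy(2)]
        triangle[OF pM[OF xy(1)] xy(1) pM[OF xy(2)]] triangle[OF xy pM[OF xy(2)]]
      by linarith
    moreover have "e x y = g (d (p x) (p y))" using False xy by (simp add: e_def)
    ultimately show ?thesis
      using g_lower[of "d (p x) (p y)"] g_upper[of "d (p x) (p y)"] K by linarith
  qed (use xy K in \<open>simp add: e_def\<close>)
  then have "Met_dist X d e \<le> ennreal (2 * K)"
    unfolding Met_dist_def M_def[symmetric] by (intro SUP_least) (auto intro: ennreal_leI)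
  ultimately show thesis using that gap by blast
qed

section \<open>The topology of the space of metrics\<close>

lemma Met_dist_self [simp]: "Met_dist X d d = 0"
  by (auto simp: Met_dist_def intro!: SUP_eqI)

lemma Met_dist_triangle: "Met_dist X d f \<le> Met_dist X d e + Met_dist X e f"
  unfolding Met_dist_def[of X d f]
proof (intro SUP_least, clarify)
  fix x y assume xy: "x \<in> topspace X" "y \<in> topspace X"
  have "ennreal \<bar>d x y - f x y\<bar> \<le> ennreal \<bar>d x y - e x y\<bar> + ennreal \<bar>e x y - f x y\<bar>"
    by (simp flip: ennreal_plus)
  also have "\<dots> \<le> Met_dist X d e + Met_dist X e f"
    using xy unfolding Met_dist_def by (intro add_mono SUP_upper2[of "(x, y)"]) auto
  finally show "ennreal \<bar>d x y - f x y\<bar> \<le> Met_dist X d e + Met_dist X e f" .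
qed

lemma Met_dist_lessD:
  assumes "Met_dist X d e < ennreal r" "x \<in> topspace X" "y \<in> topspace X"
  shows "\<bar>d x y - e x y\<bar> < r"
proof -
  have "ennreal \<bar>d x y - e x y\<bar> \<le> Met_dist X d e"
    using assms(2,3) unfolding Met_dist_def by (intro SUP_upper2[of "(x, y)"]) auto
  then have "ennreal \<bar>d x y - e x y\<bar> < ennreal r"
    using assms(1) by (rule le_less_trans)
  then show ?thesis by (simp add: ennreal_less_iff)
qed

lemma openin_Met_ball:
  assumes "d \<in> Met X" "0 < r"
  shows "openin (Met_topology X) {e \<in> Met X. Met_dist X d e < r}"
  unfolding Met_topology_def using assms by (intro topology_generated_by_Basis) blast

lemma topspace_Met_topology: "topspace (Met_topology X) = Met X"
proof -
  have "d \<in> topspace (Met_topology X)" if "d \<in> Met X" for d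
    using openin_subset[OF openin_Met_ball[OF that zero_less_one]] that by auto
  moreover have "topspace (Met_topology X) \<subseteq> Met X"
    unfolding Met_topology_def topology_generated_by_topspace by auto
  ultimately show ?thesis by blast
qed

text \<open>By definition the balls only form a subbasis. Containing a ball about each of its points
  passes to finite intersections and to unions, and holds for balls by the triangle
  inequality.\<close>

lemma openin_Met_topologyD:
  assumes "openin (Met_topology X) U" "d \<in> U"
  obtains r where "0 < r" "{e \<in> Met X. Met_dist X d e < r} \<subseteq> U"
proof -
  let ?P = "\<lambda>U. \<forall>d\<in>U. \<exists>r>0. {e \<in> Met X. Met_dist X d e < r} \<subseteq> U"
  have "?P U"
    using assms(1) unfolding Met_topology_def openin_topology_generated_by_iff
  proof (induction rule: generate_topology_on.induct)
    case (Int a b)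
    show ?case
    proof
      fix d assume "d \<in> a \<inter> b"
      then obtain r s where "0 < r" "{e \<in> Met X. Met_dist X d e < r} \<subseteq> a"
        "0 < s" "{e \<in> Met X. Met_dist X d e < s} \<subseteq> b" using Int by blast
      then show "\<exists>r>0. {e \<in> Met X. Met_dist X d e < r} \<subseteq> a \<inter> b"
        by (intro exI[of _ "min r s"]) auto
    qed
  next
    case (UN K)
    then show ?case by (meson Union_iff Union_upper subset_trans)
  next
    case (Basis s)
    then obtain c r where s: "s = {e \<in> Met X. Met_dist X c e < r}" by blast
    show ?case
    proof
      fix d assume "d \<in> s"
      then have cd: "Met_dist X c d < r" by (simp add: s)
      \<comment> \<open>Radii may be infinite, but \<open>cd\<close> makes
        \<open>Met_dist X c d\<close> finite, so the subtraction can be undone.\<close>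
      have "Met_dist X c e < r" if "Met_dist X d e < r - Met_dist X c d" for e
      proof -
        have "Met_dist X c d + Met_dist X d e < r"
          using that cd less_diff_eq_ennreal[of r "Met_dist X c d"]
          by (simp add: add.commute less_top[symmetric] order.strict_implies_not_eq
              less_le_trans[OF _ top_greatest])
        with Met_dist_triangle[of X c e d] show ?thesis by (rule le_less_trans)
      qed
      then show "\<exists>r>0. {e \<in> Met X. Met_dist X d e < r} \<subseteq> s"
        using cd by (intro exI[of _ "r - Met_dist X c d"]) (auto simp: s diff_gr0_ennreal)
    qed
  qed simp
  with assms(2) that show thesis by blast
qed

section \<open>Values of universal metrics, and meagerness\<close>

lemma T_Met_attains:
  assumes "d \<in> T_Met X S" "s \<in> S" "0 < s" "0 \<in> S"
  obtains x y where "x \<in> topspace X" "y \<in> topspace X" "d x y = s"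
proof -
  define c :: "nat \<Rightarrow> nat \<Rightarrow> real" where "c i j = (if i = j then 0 else s)" for i j
  interpret C: Metric_space "{0, Suc 0}" c
    using \<open>0 < s\<close> by unfold_locales (auto simp: c_def)
  interpret D: Metric_space "topspace X" d
    using assms(1) by (simp add: T_Met_def Met_def)
  have "metric ({0, Suc 0}, c) \<in> two_point_spaces S"
    using assms by (auto simp: two_point_spaces_def C.mspace_metric C.mdist_metric c_def)
  then obtain f where "isometric_embedding (metric ({0, Suc 0}, c)) (metric (topspace X, d)) f"
    using assms(1) unfolding T_Met_def universal_metric_def by blast
  then have "f 0 \<in> topspace X" "f (Suc 0) \<in> topspace X" "d (f 0) (f (Suc 0)) = s"
    unfolding isometric_embedding_def
    by (auto simp: C.mspace_metric C.mdist_metric D.mspace_metric D.mdist_metric c_def)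
  then show thesis by (rule that)
qed

theorem theorem3p11:
  fixes X :: "'a topology" and S :: "real set"
  assumes "S \<subseteq> {0..}" and "{0..} \<subseteq> closure S" and "0 \<in> S"
    and "metrizable_space X" and "strongly_0_dimensional X"
  shows "meager_in (Met_topology X) (CT_Met X S)"
proof -
  let ?I = "Met_topology X interior_of CT_Met X S"
  have "?I = {}"
  proof (rule ccontr)
    assume "?I \<noteq> {}"
    then obtain d where d: "d \<in> ?I" by blast
    then have dM: "d \<in> Met X"
      using interior_of_subset_topspace[of "Met_topology X"] by (auto simp: topspace_Met_topology)
    obtain r where r: "0 < r" "{e \<in> Met X. Met_dist X d e < r} \<subseteq> ?I"
      using openin_Met_topologyD[OF openin_interior_of d] by blast
    obtain \<epsilon> where \<epsilon>: "0 < \<epsilon>" "ennreal \<epsilon> < r"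
      using dense[OF r(1)] by (metis ennreal_cases ennreal_less_zero_iff top.extremum_strict)
    \<comment> \<open>Chosen so that the error \<open>2 * K\<close> equals
      \<open>\<epsilon>\<close>, which is below \<open>r\<close>.\<close>
    define K where "K = \<epsilon> / 2"
    have K: "0 < K" using \<epsilon> by (simp add: K_def)
    obtain e where e: "e \<in> Met X" "Met_dist X d e \<le> ennreal (2 * K)"
      and gap: "\<And>x y. e x y < K / 4 \<or> K \<le> e x y"
      using exists_near_metric_omitting_interval[OF assms(5) dM K] by blast
    have "Met_dist X d e < r"
      using e(2) \<epsilon>(2) by (simp add: K_def)
    with e(1) r(2) have "e \<in> ?I" by blast
    then have cl: "e \<in> Met_topology X closure_of T_Met X S"
      using interior_of_subset[of "Met_topology X" "CT_Met X S"] unfolding CT_Met_def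
      by (rule subsetD[rotated])
    \<comment> \<open>Any metric in \<open>?B\<close> moves values of \<open>e\<close> by less than
      \<open>K / 8\<close>. A value \<open>s\<close> within \<open>K / 8\<close> of
      \<open>K / 2\<close> thus forces a value of \<open>e\<close> strictly between
      \<open>K / 4\<close> and \<open>3 * K / 4\<close>, inside the gap.\<close>
    let ?B = "{f \<in> Met X. Met_dist X e f < ennreal (K / 8)}"
    have "openin (Met_topology X) ?B" "e \<in> ?B"
      using e K openin_Met_ball[of e X "ennreal (K / 8)"] by auto
    then have "\<exists>f. f \<in> T_Met X S \<and> f \<in> ?B"
      using cl unfolding in_closure_of by (elim conjE allE[of _ ?B] impE) auto
    then obtain f where f: "f \<in> T_Met X S" "Met_dist X e f < ennreal (K / 8)"
      by (elim exE conjE CollectE)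
    have "K / 2 \<in> closure S" using assms(2) K by auto
    then obtain s where s: "s \<in> S" "dist s (K / 2) < K / 8"
      using K unfolding closure_approachable by (auto dest: spec[of _ "K / 8"])
    then have sK: "3 * K / 8 < s" "s < 5 * K / 8"
      unfolding dist_real_def by linarith+
    obtain x y where xy: "x \<in> topspace X" "y \<in> topspace X" "f x y = s"
      using T_Met_attains[OF f(1) s(1)] sK K assms(3) by auto
    with Met_dist_lessD[OF f(2)] have "\<bar>e x y - s\<bar> < K / 8" by blast
    with gap[of x y] sK K show False by linarith
  qed
  \<comment> \<open>\<open>CT_Met X S\<close> is closed, so empty interior makes it nowhere dense,
    and a single set suffices for meagerness.\<close>
  then have "nowhere_dense_in (Met_topology X) (CT_Met X S)"
    unfolding nowhere_dense_in_def CT_Met_def by (simp add: closure_of_subset_topspace)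
  then show ?thesis
    unfolding meager_in_def by (intro exI[of _ "{CT_Met X S}"]) simp
qed

end
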